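(* Let $\mathcal{B}$ be a Gray monoid, let $(A,p,\alpha)$ be a skew semimonoidale in $\mathcal{B}$, and let $(j,\lambda,\rho)$ and $(j',\lambda',\rho')$ be objects of $\mathcal{U}(A,p,\alpha)$. Then there is exactly one morphism from $(j,\lambda,\rho)$ to $(j',\lambda',\rho')$ in $\mathcal{U}(A,p,\alpha)$.
   Context: Gray monoid. A Gray monoid $\mathcal{B}$ is a 2-category with an object $I$ and, for all objects $A,B$, 2-functors $A\otimes-$ and $-\otimes B:\mathcal{B}\to\mathcal{B}$ which agree on objects (common value $A\otimes B$), are strictly unital and associative ($I\otimes-$ and $-\otimes I$ are identities; $A\otimes(B\otimes-)=(A\otimes B)\otimes-$; $(-\otimes A)\otimes B=-\otimes(A\otimes B)$; $(A\otimes-)\otimes B=A\otimes(-\otimes B)$), together with, for 1-cells $f:A\to A'$, $g:B\to B'$, an invertible 2-cell $$c_{f,g}:(1_{A'}\otimes g)(f\otimes 1_B)\Rightarrow(f\otimes 1_{B'})(1_A\otimes g),$$ where $f\otimes 1_B$ and $1_A\otimes g$ denote the images under $-\otimes B$ and $A\otimes-$. These 2-cells are natural with respect to 2-cells $f\Rightarrow f_1$, $g\Rightarrow g_1$; are identities if $f$ or $g$ is an identity; satisfy $c_{f'f,g}=((f'\otimes1)c_{f,g})\circ(c_{f',g}(f\otimes1))$ and $c_{f,g'g}=(c_{f,g'}(1\otimes g))\circ((1\otimes g')c_{f,g})$; and satisfy $1_C\otimes c_{f,g}=c_{1_C\otimes f,g}$, $c_{f\otimes1_C,g}=c_{f,1_C\otimes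 g}$, $c_{f,g}\otimes1_C=c_{f,g\otimes1_C}$. Below $1$ denotes identity 1-cells, juxtaposition denotes composition of 1-cells and whiskering, and $\circ$ is vertical composition. Skew semimonoidale. A skew semimonoidale $(A,p,\alpha)$ in $\mathcal{B}$ is an object $A$ with a 1-cell $p:A\otimes A\to A$ and a 2-cell (not assumed invertible) $\alpha:p(p\otimes1)\Rightarrow p(1\otimes p)$ such that, as 2-cells $p(p\otimes1)(p\otimes1\otimes1)\Rightarrow p(1\otimes p)(1\otimes1\otimes p)$, $$(\alpha(1\otimes1\otimes p))\circ(p\,c_{p,p})\circ(\alpha(p\otimes1\otimes1))=(p(1\otimes\alpha))\circ(\alpha(1\otimes p\otimes1))\circ(p(\alpha\otimes1)).$$ Category of units. The objects of $\mathcal{U}(A,p,\alpha)$, called units, are triples $(j,\lambda,\rho)$ with $j:I\to A$ a 1-cell and $\lambda:p(j\otimes1)\Rightarrow1_A$, $\rho:1_A\Rightarrow p(1\otimes j)$ 2-cells (not assumed invertible) such that: - $(\lambda p)\circ(p\,c_{j,p})\circ(\alpha(j\otimes1\otimes1))=p(\lambda\otimes1)$; - $(\alpha(1\otimes1\otimes j))\circ(p\,c_{p,j})\circ(\rho p)=p(1\otimes\rho)$; - $(p(1\otimes\lambda))\circ(\alpha(1\otimes j\otimes1))\circ(p(\rho\otimes1))=1_p$; - $(\lambda j)\circ(p\,c_{j,j})\circ(\rho j)=1_j$. A morphism $(j',\lambda',\rho')\to(j,\lambda,\rho)$ in $\mathcal{U}(A,p,\alpha)$ is a 2-cell $\varphi:j'\Rightarrow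 j$ with $\lambda\circ(p(\varphi\otimes1))=\lambda'$ and $(p(1\otimes\varphi))\circ\rho'=\rho$; composition is vertical composition of 2-cells. *)

theory Defs
  imports Main
begin

section \<open>Strict 2-categories\<close>

text \<open>Operations are total functions on the ambient types, constrained only on the carriers
  and only for composable arguments. All compositions are written in functional order:
  \<open>g \<cdot> f\<close> is first \<open>f\<close>, then \<open>g\<close>.\<close>

record ('o, 'a, 'c) two_cat =
  Obj :: "'o set"
  Arr :: "'a set"
  Dom :: "'a \<Rightarrow> 'o"
  Cod :: "'a \<Rightarrow> 'o"
  Id1 :: "'o \<Rightarrow> 'a" ("\<one>\<index>")
  Comp1 :: "'a \<Rightarrow> 'a \<Rightarrow> 'a" (infixr "\<cdot>\<index>" 75)
  Cell :: "'c set"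
  Src :: "'c \<Rightarrow> 'a"
  Tgt :: "'c \<Rightarrow> 'a"
  Id2 :: "'a \<Rightarrow> 'c" ("\<iota>\<index>")
  VComp :: "'c \<Rightarrow> 'c \<Rightarrow> 'c" (infixr "\<bullet>\<index>" 65)
  HComp :: "'c \<Rightarrow> 'c \<Rightarrow> 'c" (infixr "\<star>\<index>" 75)

definition hom1 :: "('o, 'a, 'c, 'm) two_cat_scheme \<Rightarrow> 'o \<Rightarrow> 'o \<Rightarrow> 'a set" where
  "hom1 B X Y = {f \<in> Arr B. Dom B f = X \<and> Cod B f = Y}"

definition hom2 :: "('o, 'a, 'c, 'm) two_cat_scheme \<Rightarrow> 'a \<Rightarrow> 'a \<Rightarrow> 'c set" where
  "hom2 B f g = {x \<in> Cell B. Src B x = f \<and> Tgt B x = g}"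

definition lwhisk :: "('o, 'a, 'c, 'm) two_cat_scheme \<Rightarrow> 'a \<Rightarrow> 'c \<Rightarrow> 'c" (infixr "\<rhd>\<index>" 75) where
  "f \<rhd>\<^bsub>B\<^esub> x = \<iota>\<^bsub>B\<^esub> f \<star>\<^bsub>B\<^esub> x"

definition rwhisk :: "('o, 'a, 'c, 'm) two_cat_scheme \<Rightarrow> 'c \<Rightarrow> 'a \<Rightarrow> 'c" (infixl "\<lhd>\<index>" 75) where
  "x \<lhd>\<^bsub>B\<^esub> f = x \<star>\<^bsub>B\<^esub> \<iota>\<^bsub>B\<^esub> f"

definition invertible2 :: "('o, 'a, 'c, 'm) two_cat_scheme \<Rightarrow> 'c \<Rightarrow> bool" where
  "invertible2 B x \<longleftrightarrow>
    (\<exists>y \<in> hom2 B (Tgt B x) (Src B x).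
      y \<bullet>\<^bsub>B\<^esub> x = \<iota>\<^bsub>B\<^esub> (Src B x) \<and> x \<bullet>\<^bsub>B\<^esub> y = \<iota>\<^bsub>B\<^esub> (Tgt B x))"

locale two_category =
  fixes B :: "('o, 'a, 'c, 'm) two_cat_scheme" (structure)
  assumes dom_obj: "f \<in> Arr B \<Longrightarrow> Dom B f \<in> Obj B"
    and cod_obj: "f \<in> Arr B \<Longrightarrow> Cod B f \<in> Obj B"
    and src_arr: "x \<in> Cell B \<Longrightarrow> Src B x \<in> Arr B"
    and tgt_arr: "x \<in> Cell B \<Longrightarrow> Tgt B x \<in> Arr B"
    and dom_parallel: "x \<in> Cell B \<Longrightarrow> Dom B (Tgt B x) = Dom B (Src B x)"
    and cod_parallel: "x \<in> Cell B \<Longrightarrow> Cod B (Tgt B x) = Cod B (Src B x)"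
    and id1_hom: "X \<in> Obj B \<Longrightarrow> \<one> X \<in> hom1 B X X"
    and comp1_hom: "\<lbrakk>f \<in> hom1 B X Y; g \<in> hom1 B Y Z\<rbrakk> \<Longrightarrow> g \<cdot> f \<in> hom1 B X Z"
    and comp1_id_left: "f \<in> hom1 B X Y \<Longrightarrow> \<one> Y \<cdot> f = f"
    and comp1_id_right: "f \<in> hom1 B X Y \<Longrightarrow> f \<cdot> \<one> X = f"
    and comp1_assoc: "\<lbrakk>f \<in> hom1 B W X; g \<in> hom1 B X Y; h \<in> hom1 B Y Z\<rbrakk>
      \<Longrightarrow> (h \<cdot> g) \<cdot> f = h \<cdot> (g \<cdot> f)"
    and id2_hom: "f \<in> Arr B \<Longrightarrow> \<iota> f \<in> hom2 B f f"
    and vcomp_hom: "\<lbrakk>x \<in> hom2 B f g; y \<in> hom2 B g h\<rbrakk> \<Longrightarrow> y \<bullet> x \<in> hom2 B f h"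
    and vcomp_id_left: "x \<in> hom2 B f g \<Longrightarrow> \<iota> g \<bullet> x = x"
    and vcomp_id_right: "x \<in> hom2 B f g \<Longrightarrow> x \<bullet> \<iota> f = x"
    and vcomp_assoc: "\<lbrakk>x \<in> hom2 B f g; y \<in> hom2 B g h; z \<in> hom2 B h k\<rbrakk>
      \<Longrightarrow> (z \<bullet> y) \<bullet> x = z \<bullet> (y \<bullet> x)"
    and hcomp_hom: "\<lbrakk>f \<in> hom1 B X Y; g \<in> hom1 B Y Z; x \<in> hom2 B f f'; y \<in> hom2 B g g'\<rbrakk>
      \<Longrightarrow> y \<star> x \<in> hom2 B (g \<cdot> f) (g' \<cdot> f')"
    and hcomp_id_left: "\<lbrakk>f \<in> hom1 B X Y; x \<in> hom2 B f f'\<rbrakk> \<Longrightarrow> \<iota> (\<one> Y) \<star> x = x"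
    and hcomp_id_right: "\<lbrakk>f \<in> hom1 B X Y; x \<in> hom2 B f f'\<rbrakk> \<Longrightarrow> x \<star> \<iota> (\<one> X) = x"
    and hcomp_assoc: "\<lbrakk>f \<in> hom1 B W X; g \<in> hom1 B X Y; h \<in> hom1 B Y Z;
        x \<in> hom2 B f f'; y \<in> hom2 B g g'; z \<in> hom2 B h h'\<rbrakk>
      \<Longrightarrow> (z \<star> y) \<star> x = z \<star> (y \<star> x)"
    and hcomp_id2: "\<lbrakk>f \<in> hom1 B X Y; g \<in> hom1 B Y Z\<rbrakk> \<Longrightarrow> \<iota> g \<star> \<iota> f = \<iota> (g \<cdot> f)"
    and interchange: "\<lbrakk>f \<in> hom1 B X Y; g \<in> hom1 B Y Z;
        x \<in> hom2 B f f'; x' \<in> hom2 B f' f''; y \<in> hom2 B g g'; y' \<in> hom2 B g' g''\<rbrakk>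
      \<Longrightarrow> (y' \<bullet> y) \<star> (x' \<bullet> x) = (y' \<star> x') \<bullet> (y \<star> x)"

locale two_functor = C: two_category C + D: two_category D
  for C :: "('o1, 'a1, 'c1, 'm1) two_cat_scheme"
    and D :: "('o2, 'a2, 'c2, 'm2) two_cat_scheme" +
  fixes F0 :: "'o1 \<Rightarrow> 'o2" and F1 :: "'a1 \<Rightarrow> 'a2" and F2 :: "'c1 \<Rightarrow> 'c2"
  assumes F0_obj: "X \<in> Obj C \<Longrightarrow> F0 X \<in> Obj D"
    and F1_hom: "f \<in> hom1 C X Y \<Longrightarrow> F1 f \<in> hom1 D (F0 X) (F0 Y)"
    and F2_hom: "x \<in> hom2 C f g \<Longrightarrow> F2 x \<in> hom2 D (F1 f) (F1 g)"
    and F1_id: "X \<in> Obj C \<Longrightarrow> F1 (\<one>\<^bsub>C\<^esub> X) = \<one>\<^bsub>D\<^esub> (F0 X)"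
    and F1_comp: "\<lbrakk>f \<in> hom1 C X Y; g \<in> hom1 C Y Z\<rbrakk> \<Longrightarrow> F1 (g \<cdot>\<^bsub>C\<^esub> f) = F1 g \<cdot>\<^bsub>D\<^esub> F1 f"
    and F2_id: "f \<in> Arr C \<Longrightarrow> F2 (\<iota>\<^bsub>C\<^esub> f) = \<iota>\<^bsub>D\<^esub> (F1 f)"
    and F2_vcomp: "\<lbrakk>x \<in> hom2 C f g; y \<in> hom2 C g h\<rbrakk>
      \<Longrightarrow> F2 (y \<bullet>\<^bsub>C\<^esub> x) = F2 y \<bullet>\<^bsub>D\<^esub> F2 x"
    and F2_hcomp: "\<lbrakk>f \<in> hom1 C X Y; g \<in> hom1 C Y Z; x \<in> hom2 C f f'; y \<in> hom2 C g g'\<rbrakk>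
      \<Longrightarrow> F2 (y \<star>\<^bsub>C\<^esub> x) = F2 y \<star>\<^bsub>D\<^esub> F2 x"


section \<open>Gray monoids\<close>

text \<open>The 2-functor tensoring with \<open>X\<close> on the left sends an object \<open>Y\<close> to \<open>X \<otimes> Y\<close>,
  a 1-cell \<open>f\<close> to \<open>X \<ltimes> f\<close> and a 2-cell \<open>x\<close> to \<open>X \<ltimes>\<^sub>2 x\<close>; the one tensoring on the right
  is given by \<open>\<otimes>\<close>, \<open>\<rtimes>\<close> and \<open>\<rtimes>\<^sub>2\<close>. The shared \<open>\<otimes>\<close> builds in that the two families agree on
  objects. There is no tensor product of two 1-cells. The 2-cell \<open>\<chi> f g\<close> is usually
  written $c_{f,g}$.\<close>

record ('o, 'a, 'c) gray_data = "('o, 'a, 'c) two_cat" +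
  UnitObj :: "'o" ("\<I>\<index>")
  Tensor :: "'o \<Rightarrow> 'o \<Rightarrow> 'o" (infixr "\<otimes>\<index>" 80)
  LTensor1 :: "'o \<Rightarrow> 'a \<Rightarrow> 'a" (infixr "\<ltimes>\<index>" 80)
  LTensor2 :: "'o \<Rightarrow> 'c \<Rightarrow> 'c" (infixr "\<ltimes>\<^sub>2\<index>" 80)
  RTensor1 :: "'a \<Rightarrow> 'o \<Rightarrow> 'a" (infixl "\<rtimes>\<index>" 80)
  RTensor2 :: "'c \<Rightarrow> 'o \<Rightarrow> 'c" (infixl "\<rtimes>\<^sub>2\<index>" 80)
  Interchanger :: "'a \<Rightarrow> 'a \<Rightarrow> 'c" ("\<chi>\<index>")

locale gray_monoid = two_category B
  for B :: "('o, 'a, 'c, 'm) gray_data_scheme" (structure) +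
  assumes unit_obj: "\<I> \<in> Obj B"
    and ltensor_functor: "X \<in> Obj B
      \<Longrightarrow> two_functor B B (\<lambda>Y. X \<otimes> Y) (\<lambda>f. X \<ltimes> f) (\<lambda>x. X \<ltimes>\<^sub>2 x)"
    and rtensor_functor: "Y \<in> Obj B
      \<Longrightarrow> two_functor B B (\<lambda>X. X \<otimes> Y) (\<lambda>f. f \<rtimes> Y) (\<lambda>x. x \<rtimes>\<^sub>2 Y)"
    \<comment> \<open>strict unitality\<close>
    and lunit0: "X \<in> Obj B \<Longrightarrow> \<I> \<otimes> X = X"
    and lunit1: "f \<in> Arr B \<Longrightarrow> \<I> \<ltimes> f = f"
    and lunit2: "x \<in> Cell B \<Longrightarrow> \<I> \<ltimes>\<^sub>2 x = x"
    and runit0: "X \<in> Obj B \<Longrightarrow> X \<otimes> \<I> = X"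
    and runit1: "f \<in> Arr B \<Longrightarrow> f \<rtimes> \<I> = f"
    and runit2: "x \<in> Cell B \<Longrightarrow> x \<rtimes>\<^sub>2 \<I> = x"
    \<comment> \<open>strict associativity\<close>
    and assoc0: "\<lbrakk>X \<in> Obj B; Y \<in> Obj B; Z \<in> Obj B\<rbrakk> \<Longrightarrow> X \<otimes> (Y \<otimes> Z) = (X \<otimes> Y) \<otimes> Z"
    and assoc1_left: "\<lbrakk>X \<in> Obj B; Y \<in> Obj B; f \<in> Arr B\<rbrakk> \<Longrightarrow> X \<ltimes> (Y \<ltimes> f) = (X \<otimes> Y) \<ltimes> f"
    and assoc1_right: "\<lbrakk>X \<in> Obj B; Y \<in> Obj B; f \<in> Arr B\<rbrakk> \<Longrightarrow> (f \<rtimes> X) \<rtimes> Y = f \<rtimes> (X \<otimes> Y)"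
    and assoc1_mid: "\<lbrakk>X \<in> Obj B; Y \<in> Obj B; f \<in> Arr B\<rbrakk> \<Longrightarrow> (X \<ltimes> f) \<rtimes> Y = X \<ltimes> (f \<rtimes> Y)"
    and assoc2_left: "\<lbrakk>X \<in> Obj B; Y \<in> Obj B; x \<in> Cell B\<rbrakk>
      \<Longrightarrow> X \<ltimes>\<^sub>2 (Y \<ltimes>\<^sub>2 x) = (X \<otimes> Y) \<ltimes>\<^sub>2 x"
    and assoc2_right: "\<lbrakk>X \<in> Obj B; Y \<in> Obj B; x \<in> Cell B\<rbrakk>
      \<Longrightarrow> (x \<rtimes>\<^sub>2 X) \<rtimes>\<^sub>2 Y = x \<rtimes>\<^sub>2 (X \<otimes> Y)"
    and assoc2_mid: "\<lbrakk>X \<in> Obj B; Y \<in> Obj B; x \<in> Cell B\<rbrakk>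
      \<Longrightarrow> (X \<ltimes>\<^sub>2 x) \<rtimes>\<^sub>2 Y = X \<ltimes>\<^sub>2 (x \<rtimes>\<^sub>2 Y)"
    \<comment> \<open>the interchange 2-cells\<close>
    and chi_hom: "\<lbrakk>f \<in> hom1 B X X'; g \<in> hom1 B Y Y'\<rbrakk>
      \<Longrightarrow> \<chi> f g \<in> hom2 B ((X' \<ltimes> g) \<cdot> (f \<rtimes> Y)) ((f \<rtimes> Y') \<cdot> (X \<ltimes> g))"
    and chi_invertible: "\<lbrakk>f \<in> Arr B; g \<in> Arr B\<rbrakk> \<Longrightarrow> invertible2 B (\<chi> f g)"
    and chi_natural: "\<lbrakk>f \<in> hom1 B X X'; g \<in> hom1 B Y Y'; x \<in> hom2 B f f1; y \<in> hom2 B g g1\<rbrakk>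
      \<Longrightarrow> \<chi> f1 g1 \<bullet> ((X' \<ltimes>\<^sub>2 y) \<star> (x \<rtimes>\<^sub>2 Y)) = ((x \<rtimes>\<^sub>2 Y') \<star> (X \<ltimes>\<^sub>2 y)) \<bullet> \<chi> f g"
    and chi_id_left: "\<lbrakk>X \<in> Obj B; g \<in> Arr B\<rbrakk> \<Longrightarrow> \<chi> (\<one> X) g = \<iota> (X \<ltimes> g)"
    and chi_id_right: "\<lbrakk>f \<in> Arr B; Y \<in> Obj B\<rbrakk> \<Longrightarrow> \<chi> f (\<one> Y) = \<iota> (f \<rtimes> Y)"
    and chi_comp_left: "\<lbrakk>f \<in> hom1 B X X'; f' \<in> hom1 B X' X''; g \<in> hom1 B Y Y'\<rbrakk>
      \<Longrightarrow> \<chi> (f' \<cdot> f) g = ((f' \<rtimes> Y') \<rhd> \<chi> f g) \<bullet> (\<chi> f' g \<lhd> (f \<rtimes> Y))"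
    and chi_comp_right: "\<lbrakk>f \<in> hom1 B X X'; g \<in> hom1 B Y Y'; g' \<in> hom1 B Y' Y''\<rbrakk>
      \<Longrightarrow> \<chi> f (g' \<cdot> g) = (\<chi> f g' \<lhd> (X \<ltimes> g)) \<bullet> ((X' \<ltimes> g') \<rhd> \<chi> f g)"
    and chi_tensor_left: "\<lbrakk>Z \<in> Obj B; f \<in> Arr B; g \<in> Arr B\<rbrakk> \<Longrightarrow> Z \<ltimes>\<^sub>2 \<chi> f g = \<chi> (Z \<ltimes> f) g"
    and chi_tensor_mid: "\<lbrakk>Z \<in> Obj B; f \<in> Arr B; g \<in> Arr B\<rbrakk> \<Longrightarrow> \<chi> (f \<rtimes> Z) g = \<chi> f (Z \<ltimes> g)"
    and chi_tensor_right: "\<lbrakk>Z \<in> Obj B; f \<in> Arr B; g \<in> Arr B\<rbrakk> \<Longrightarrow> \<chi> f g \<rtimes>\<^sub>2 Z = \<chi> f (g \<rtimes> Z)"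


section \<open>Skew semimonoidales and their units\<close>

locale skew_semimonoidale = gray_monoid B
  for B :: "('o, 'a, 'c, 'm) gray_data_scheme" (structure) +
  fixes A :: 'o and p :: 'a and \<alpha> :: 'c
  assumes A_obj: "A \<in> Obj B"
    and p_hom: "p \<in> hom1 B (A \<otimes> A) A"
    and alpha_hom: "\<alpha> \<in> hom2 B (p \<cdot> (p \<rtimes> A)) (p \<cdot> (A \<ltimes> p))"
    and pentagon:
      "(\<alpha> \<lhd> ((A \<otimes> A) \<ltimes> p)) \<bullet> (p \<rhd> \<chi> p p) \<bullet> (\<alpha> \<lhd> (p \<rtimes> (A \<otimes> A)))
       = (p \<rhd> (A \<ltimes>\<^sub>2 \<alpha>)) \<bullet> (\<alpha> \<lhd> (A \<ltimes> (p \<rtimes> A))) \<bullet> (p \<rhd> (\<alpha> \<rtimes>\<^sub>2 A))"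

text \<open>The category of units: objects are triples \<open>(j, l, r)\<close>, and \<open>unit_hom B A p u v\<close> is the set
  of morphisms from \<open>u\<close> to \<open>v\<close>; composition is vertical composition.\<close>

definition units ::
    "('o, 'a, 'c, 'm) gray_data_scheme \<Rightarrow> 'o \<Rightarrow> 'a \<Rightarrow> 'c \<Rightarrow> ('a \<times> 'c \<times> 'c) set"
  where
  "units B A p \<alpha> = {(j, l, r).
     j \<in> hom1 B \<I> A \<and>
     l \<in> hom2 B (p \<cdot> (j \<rtimes> A)) (\<one> A) \<and>
     r \<in> hom2 B (\<one> A) (p \<cdot> (A \<ltimes> j)) \<and>
     (l \<lhd> p) \<bullet> (p \<rhd> \<chi> j p) \<bullet> (\<alpha> \<lhd> (j \<rtimes> (A \<otimes> A))) = p \<rhd> (l \<rtimes>\<^sub>2 A) \<and>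
     (\<alpha> \<lhd> ((A \<otimes> A) \<ltimes> j)) \<bullet> (p \<rhd> \<chi> p j) \<bullet> (r \<lhd> p) = p \<rhd> (A \<ltimes>\<^sub>2 r) \<and>
     (p \<rhd> (A \<ltimes>\<^sub>2 l)) \<bullet> (\<alpha> \<lhd> (A \<ltimes> (j \<rtimes> A))) \<bullet> (p \<rhd> (r \<rtimes>\<^sub>2 A)) = \<iota> p \<and>
     (l \<lhd> j) \<bullet> (p \<rhd> \<chi> j j) \<bullet> (r \<lhd> j) = \<iota> j}"
  for B (structure)

definition unit_hom ::
    "('o, 'a, 'c, 'm) gray_data_scheme \<Rightarrow> 'o \<Rightarrow> 'a \<Rightarrow> 'a \<times> 'c \<times> 'c \<Rightarrow> 'a \<times> 'c \<times> 'c \<Rightarrow> 'c set"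
  where
  "unit_hom B A p = (\<lambda>(j, l, r) (j', l', r').
     {\<phi> \<in> hom2 B j j'. l' \<bullet> (p \<rhd> (\<phi> \<rtimes>\<^sub>2 A)) = l \<and> (p \<rhd> (A \<ltimes>\<^sub>2 \<phi>)) \<bullet> r = r'})"
  for B (structure)

end

theory Submission
  imports Defs
begin

text \<open>The unit 2-cells of \<open>(j, l, r)\<close> live at the identity of \<open>A\<close>, but they extend to every
  1-cell into \<open>A\<close>: whiskering them with such a 1-cell and sliding \<open>j\<close> past that 1-cell with
  an interchanger gives families
  \[ E_g : p \cdot (A \otimes g) \cdot (j \otimes 1) \Rightarrow g, \qquad
     F_f : f \Rightarrow p \cdot (f \otimes 1) \cdot (1 \otimes j), \]
  called \<open>lunitor\<close> and \<open>runitor\<close> below. They are natural, take the values \<open>l\<close> and \<open>r\<close> at the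
  identity of \<open>A\<close>, and turn the four unit axioms into the familiar calculus of left and right
  unit constraints, with variable arguments \<open>g\<close> and \<open>f\<close>.

  If a monoid has a left unit \<open>j\<close> and a right unit \<open>j'\<close>, then \<open>j' = j j' = j\<close>. The directed version
  of this computation is the 2-cell
  \[ j \Rightarrow p \cdot (A \otimes j') \cdot j \Rightarrow j', \]
  where the first step is \<open>r'\<close> whiskered with \<open>j\<close> and the second is $E_{j'}$; this is
  \<open>comparison\<close>.

  Uniqueness: if \<open>\<phi>\<close> is a morphism, then \<open>r'\<close> is \<open>r\<close> followed by the image of \<open>\<phi>\<close>. Naturality
  of $E$ moves \<open>\<phi>\<close> to the outside of the comparison, and what remains inside is the composite
  \<open>j \<Rightarrow> j\<close> that the last unit axiom declares to be an identity (\<open>unit_hom_eq_comparison\<close>).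

  Existence: the comparison is compatible with \<open>l\<close> because $p(E_g \otimes 1)$ can be
  rewritten as \<open>\<alpha>\<close> followed by the single constraint $E_{p(g \otimes 1)}$
  (\<open>lunitor_rtensor\<close>). For \<open>g = j'\<close>, naturality of $E$ at \<open>l'\<close> then brings together \<open>r'\<close>,
  \<open>\<alpha>\<close> and \<open>l'\<close> in exactly the order of the triangle axiom of the second unit, and only \<open>l\<close> is
  left (\<open>comparison_left\<close>). Compatibility with \<open>r\<close> is the dual argument, which uses the
  triangle axiom of the first unit (\<open>comparison_right\<close>).\<close>

section \<open>Typed rewriting in 2-categories\<close>

text \<open>Stated with domains, codomains, sources and targets as functions instead of membership in
  hom-sets, the axioms of a 2-category are conditional rewrite rules whose side conditions are
  again solved by rewriting. Together they bring a pasting composite into normal form: a vertical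
  composite, bracketed to the right, of 2-cells \<open>g \<rhd> (x \<lhd> f)\<close>. Only the exchange of two
  independent 2-cells has no preferred direction and stays explicit.\<close>

context two_category
begin

lemmas [simp] = dom_obj cod_obj src_arr tgt_arr dom_parallel cod_parallel

lemma id1_typing [simp]:
  assumes "X \<in> Obj B"
  shows "\<one> X \<in> Arr B" "Dom B (\<one> X) = X" "Cod B (\<one> X) = X"
  using id1_hom[OF assms] by (auto simp: hom1_def)

lemma comp1_typing [simp]:
  assumes "f \<in> Arr B" "g \<in> Arr B" "Dom B g = Cod B f"
  shows "g \<cdot> f \<in> Arr B" "Dom B (g \<cdot> f) = Dom B f" "Cod B (g \<cdot> f) = Cod B g"
  using comp1_hom[of f _ _ g] assms by (auto simp: hom1_def)

lemma comp1_unit [simp]: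
  assumes "f \<in> Arr B"
  shows "Y = Cod B f \<Longrightarrow> \<one> Y \<cdot> f = f" "X = Dom B f \<Longrightarrow> f \<cdot> \<one> X = f"
  using assms comp1_id_left comp1_id_right by (auto simp: hom1_def)

lemma comp1_assoc' [simp]:
  assumes "f \<in> Arr B" "g \<in> Arr B" "h \<in> Arr B" "Dom B g = Cod B f" "Dom B h = Cod B g"
  shows "(h \<cdot> g) \<cdot> f = h \<cdot> (g \<cdot> f)"
  using assms comp1_assoc by (auto simp: hom1_def)

lemma id2_typing [simp]:
  assumes "f \<in> Arr B"
  shows "\<iota> f \<in> Cell B" "Src B (\<iota> f) = f" "Tgt B (\<iota> f) = f"
  using id2_hom[OF assms] by (auto simp: hom2_def)

lemma vcomp_typing [simp]:
  assumes "x \<in> Cell B" "y \<in> Cell B" "Src B y = Tgt B x"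
  shows "y \<bullet> x \<in> Cell B" "Src B (y \<bullet> x) = Src B x" "Tgt B (y \<bullet> x) = Tgt B y"
  using vcomp_hom[of x _ _ y] assms by (auto simp: hom2_def)

lemma vcomp_unit [simp]:
  assumes "x \<in> Cell B"
  shows "g = Tgt B x \<Longrightarrow> \<iota> g \<bullet> x = x" "f = Src B x \<Longrightarrow> x \<bullet> \<iota> f = x"
  using assms vcomp_id_left vcomp_id_right by (auto simp: hom2_def)

lemma vcomp_assoc' [simp]:
  assumes "x \<in> Cell B" "y \<in> Cell B" "z \<in> Cell B" "Src B y = Tgt B x" "Src B z = Tgt B y"
  shows "(z \<bullet> y) \<bullet> x = z \<bullet> (y \<bullet> x)"
  using assms vcomp_assoc by (auto simp: hom2_def)

lemma lwhisk_typing [simp]: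
  assumes "x \<in> Cell B" "g \<in> Arr B" "Dom B g = Cod B (Src B x)"
  shows "g \<rhd> x \<in> Cell B" "Src B (g \<rhd> x) = g \<cdot> Src B x" "Tgt B (g \<rhd> x) = g \<cdot> Tgt B x"
  using hcomp_hom[of "Src B x" _ _ g _ x _ "\<iota> g" g] assms
  by (auto simp: hom1_def hom2_def lwhisk_def)

lemma rwhisk_typing [simp]:
  assumes "x \<in> Cell B" "f \<in> Arr B" "Cod B f = Dom B (Src B x)"
  shows "x \<lhd> f \<in> Cell B" "Src B (x \<lhd> f) = Src B x \<cdot> f" "Tgt B (x \<lhd> f) = Tgt B x \<cdot> f"
  using hcomp_hom[of f _ _ "Src B x" _ "\<iota> f" f x] assms
  by (auto simp: hom1_def hom2_def rwhisk_def)

lemma lwhisk_vcomp [simp]: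
  assumes "x \<in> Cell B" "y \<in> Cell B" "Src B y = Tgt B x" "g \<in> Arr B" "Dom B g = Cod B (Src B x)"
  shows "g \<rhd> (y \<bullet> x) = (g \<rhd> y) \<bullet> (g \<rhd> x)"
  using interchange[of "Src B x" _ _ g _ x _ y _ "\<iota> g" g "\<iota> g" g] assms
  by (auto simp: hom1_def hom2_def lwhisk_def)

lemma rwhisk_vcomp [simp]:
  assumes "x \<in> Cell B" "y \<in> Cell B" "Src B y = Tgt B x" "f \<in> Arr B" "Cod B f = Dom B (Src B x)"
  shows "(y \<bullet> x) \<lhd> f = (y \<lhd> f) \<bullet> (x \<lhd> f)"
  using interchange[of f _ _ "Src B x" _ "\<iota> f" f "\<iota> f" f x _ y] assms
  by (auto simp: hom1_def hom2_def rwhisk_def)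

lemma whisk_id2 [simp]:
  assumes "f \<in> Arr B" "g \<in> Arr B" "Dom B g = Cod B f"
  shows "g \<rhd> \<iota> f = \<iota> (g \<cdot> f)" "\<iota> g \<lhd> f = \<iota> (g \<cdot> f)"
  using hcomp_id2[of f _ _ g] assms by (auto simp: hom1_def lwhisk_def rwhisk_def)

lemma whisk_id1 [simp]:
  assumes "x \<in> Cell B"
  shows "Y = Cod B (Src B x) \<Longrightarrow> \<one> Y \<rhd> x = x" "X = Dom B (Src B x) \<Longrightarrow> x \<lhd> \<one> X = x"
  using hcomp_id_left[of "Src B x" _ _ x] hcomp_id_right[of "Src B x" _ _ x] assms
  by (auto simp: hom1_def hom2_def lwhisk_def rwhisk_def)

lemma lwhisk_lwhisk [simp]:
  assumes "x \<in> Cell B" "g \<in> Arr B" "h \<in> Arr B" "Dom B g = Cod B (Src B x)" "Dom B h = Cod B g"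
  shows "h \<rhd> (g \<rhd> x) = (h \<cdot> g) \<rhd> x"
  using hcomp_assoc[of "Src B x" _ _ g _ h _ x _ "\<iota> g" g "\<iota> h" h] hcomp_id2[of g _ _ h] assms
  by (auto simp: hom1_def hom2_def lwhisk_def)

lemma rwhisk_rwhisk [simp]:
  assumes "x \<in> Cell B" "f \<in> Arr B" "g \<in> Arr B" "Cod B g = Dom B (Src B x)" "Dom B g = Cod B f"
  shows "(x \<lhd> g) \<lhd> f = x \<lhd> (g \<cdot> f)"
  using hcomp_assoc[of f _ _ g _ "Src B x" _ "\<iota> f" f "\<iota> g" g x] hcomp_id2[of f _ _ g] assms
  by (auto simp: hom1_def hom2_def rwhisk_def)

lemma lwhisk_rwhisk [simp]:
  assumes "x \<in> Cell B" "f \<in> Arr B" "h \<in> Arr B" "Cod B f = Dom B (Src B x)" "Dom B h = Cod B (Src B x)"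
  shows "(h \<rhd> x) \<lhd> f = h \<rhd> (x \<lhd> f)"
  using hcomp_assoc[of f _ _ "Src B x" _ h _ "\<iota> f" f x _ "\<iota> h" h] assms
  by (auto simp: hom1_def hom2_def lwhisk_def rwhisk_def)

lemma whisk_exchange:
  assumes "x \<in> Cell B" "y \<in> Cell B" "Dom B (Src B y) = Cod B (Src B x)"
  shows "(y \<lhd> Tgt B x) \<bullet> (Src B y \<rhd> x) = (Tgt B y \<rhd> x) \<bullet> (y \<lhd> Src B x)"
  using interchange[of "Src B x" _ _ "Src B y" _ x _ "\<iota> (Tgt B x)" "Tgt B x" "\<iota> (Src B y)" _ y]
    interchange[of "Src B x" _ _ "Src B y" _ "\<iota> (Src B x)" _ x "Tgt B x" y _ "\<iota> (Tgt B y)" "Tgt B y"] assms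
  by (auto simp: hom1_def hom2_def lwhisk_def rwhisk_def)

end

context two_functor
begin

lemma F1_typing:
  assumes "f \<in> Arr C"
  shows "F1 f \<in> Arr D" "Dom D (F1 f) = F0 (Dom C f)" "Cod D (F1 f) = F0 (Cod C f)"
  using F1_hom[of f] assms by (auto simp: hom1_def)

lemma F2_typing:
  assumes "x \<in> Cell C"
  shows "F2 x \<in> Cell D" "Src D (F2 x) = F1 (Src C x)" "Tgt D (F2 x) = F1 (Tgt C x)"
  using F2_hom[of x] assms by (auto simp: hom2_def)

lemma F1_comp':
  assumes "f \<in> Arr C" "g \<in> Arr C" "Dom C g = Cod C f"
  shows "F1 (g \<cdot>\<^bsub>C\<^esub> f) = F1 g \<cdot>\<^bsub>D\<^esub> F1 f"
  using F1_comp assms by (auto simp: hom1_def)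

lemma F2_vcomp':
  assumes "x \<in> Cell C" "y \<in> Cell C" "Src C y = Tgt C x"
  shows "F2 (y \<bullet>\<^bsub>C\<^esub> x) = F2 y \<bullet>\<^bsub>D\<^esub> F2 x"
  using F2_vcomp assms by (auto simp: hom2_def)

lemma F2_lwhisk:
  assumes "x \<in> Cell C" "g \<in> Arr C" "Dom C g = Cod C (Src C x)"
  shows "F2 (g \<rhd>\<^bsub>C\<^esub> x) = F1 g \<rhd>\<^bsub>D\<^esub> F2 x"
  using F2_hcomp[of "Src C x" _ _ g _ x _ "\<iota>\<^bsub>C\<^esub> g" g] assms
  by (auto simp: hom1_def hom2_def lwhisk_def F2_id)

lemma F2_rwhisk:
  assumes "x \<in> Cell C" "f \<in> Arr C" "Cod C f = Dom C (Src C x)"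
  shows "F2 (x \<lhd>\<^bsub>C\<^esub> f) = F2 x \<lhd>\<^bsub>D\<^esub> F1 f"
  using F2_hcomp[of f _ _ "Src C x" _ "\<iota>\<^bsub>C\<^esub> f" f x] assms
  by (auto simp: hom1_def hom2_def rwhisk_def F2_id)

lemmas typed_rules = F0_obj F1_typing F2_typing F1_id F1_comp' F2_id F2_vcomp' F2_lwhisk F2_rwhisk

end

section \<open>Interchangers in a Gray monoid\<close>

context gray_monoid
begin

lemmas [simp] = unit_obj two_functor.typed_rules[OF ltensor_functor]
  two_functor.typed_rules[OF rtensor_functor]
  lunit0 lunit1 lunit2 runit0 runit1 runit2 runit2 assoc0 assoc1_left assoc1_right assoc1_mid
  assoc2_left assoc2_right assoc2_mid chi_id_left chi_id_right
  chi_tensor_left chi_tensor_right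

lemma chi_typing [simp]:
  assumes "f \<in> Arr B" "g \<in> Arr B"
  shows "\<chi> f g \<in> Cell B"
    "Src B (\<chi> f g) = (Cod B f \<ltimes> g) \<cdot> (f \<rtimes> Dom B g)"
    "Tgt B (\<chi> f g) = (f \<rtimes> Cod B g) \<cdot> (Dom B f \<ltimes> g)"
  using chi_hom[of f _ _ g] assms by (auto simp: hom1_def hom2_def)

lemma chi_natural_right:
  assumes "f \<in> Arr B" "y \<in> Cell B"
  shows "\<chi> f (Tgt B y) \<bullet> ((Cod B f \<ltimes>\<^sub>2 y) \<lhd> (f \<rtimes> Dom B (Src B y)))
    = ((f \<rtimes> Cod B (Src B y)) \<rhd> (Dom B f \<ltimes>\<^sub>2 y)) \<bullet> \<chi> f (Src B y)"
  using chi_natural[of f "Dom B f" "Cod B f" "Src B y" "Dom B (Src B y)" "Cod B (Src B y)" "\<iota> f" f y "Tgt B y"] assms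
  by (auto simp: hom1_def hom2_def lwhisk_def rwhisk_def)

lemma chi_natural_left:
  assumes "x \<in> Cell B" "g \<in> Arr B"
  shows "\<chi> (Tgt B x) g \<bullet> ((Cod B (Src B x) \<ltimes> g) \<rhd> (x \<rtimes>\<^sub>2 Dom B g))
    = ((x \<rtimes>\<^sub>2 Cod B g) \<lhd> (Dom B (Src B x) \<ltimes> g)) \<bullet> \<chi> (Src B x) g"
  using chi_natural[of "Src B x" _ _ g _ _ x "Tgt B x" "\<iota> g" g] assms
  by (auto simp: hom1_def hom2_def lwhisk_def rwhisk_def)

lemma chi_comp_left':
  assumes "f \<in> Arr B" "f' \<in> Arr B" "g \<in> Arr B" "Dom B f' = Cod B f"
  shows "\<chi> (f' \<cdot> f) g = ((f' \<rtimes> Cod B g) \<rhd> \<chi> f g) \<bullet> (\<chi> f' g \<lhd> (f \<rtimes> Dom B g))"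
  using chi_comp_left assms by (auto simp: hom1_def)

lemma chi_comp_right':
  assumes "f \<in> Arr B" "g \<in> Arr B" "g' \<in> Arr B" "Dom B g' = Cod B g"
  shows "\<chi> f (g' \<cdot> g) = (\<chi> f g' \<lhd> (Dom B f \<ltimes> g)) \<bullet> ((Cod B f \<ltimes> g') \<rhd> \<chi> f g)"
  using chi_comp_right assms by (auto simp: hom1_def)

end

section \<open>Unit constraints at arbitrary 1-cells\<close>

locale skew_unit = skew_semimonoidale B A p \<alpha>
  for B :: "('o, 'a, 'c, 'm) gray_data_scheme" (structure) and A p \<alpha> +
  fixes j :: 'a and l r :: 'c
  assumes unit: "(j, l, r) \<in> units B A p \<alpha>"
begin

lemmas [simp] = A_obj

lemma p_typing [simp]: "p \<in> Arr B" "Dom B p = A \<otimes> A" "Cod B p = A"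
  using p_hom by (auto simp: hom1_def)

lemma alpha_typing [simp]:
  "\<alpha> \<in> Cell B" "Src B \<alpha> = p \<cdot> (p \<rtimes> A)" "Tgt B \<alpha> = p \<cdot> (A \<ltimes> p)"
  using alpha_hom by (auto simp: hom2_def)

lemma unit_typing [simp]:
  "j \<in> Arr B" "Dom B j = \<I>" "Cod B j = A"
  "l \<in> Cell B" "Src B l = p \<cdot> (j \<rtimes> A)" "Tgt B l = \<one> A"
  "r \<in> Cell B" "Src B r = \<one> A" "Tgt B r = p \<cdot> (A \<ltimes> j)"
  using unit by (auto simp: units_def hom1_def hom2_def)

lemma left_unit_assoc:
  "(l \<lhd> p) \<bullet> (p \<rhd> \<chi> j p) \<bullet> (\<alpha> \<lhd> (j \<rtimes> (A \<otimes> A))) = p \<rhd> (l \<rtimes>\<^sub>2 A)"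
  and right_unit_assoc:
  "(\<alpha> \<lhd> ((A \<otimes> A) \<ltimes> j)) \<bullet> (p \<rhd> \<chi> p j) \<bullet> (r \<lhd> p) = p \<rhd> (A \<ltimes>\<^sub>2 r)"
  and triangle:
  "(p \<rhd> (A \<ltimes>\<^sub>2 l)) \<bullet> (\<alpha> \<lhd> (A \<ltimes> (j \<rtimes> A))) \<bullet> (p \<rhd> (r \<rtimes>\<^sub>2 A)) = \<iota> p"
  and unit_unit: "(l \<lhd> j) \<bullet> (p \<rhd> \<chi> j j) \<bullet> (r \<lhd> j) = \<iota> j"
  using unit by (auto simp: units_def)

definition lunitor :: "'a \<Rightarrow> 'c" where
  "lunitor g = (l \<lhd> g) \<bullet> (p \<rhd> \<chi> j g)"

definition runitor :: "'a \<Rightarrow> 'c" where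
  "runitor f = (p \<rhd> \<chi> f j) \<bullet> (r \<lhd> f)"

text \<open>On 1-cells with codomain \<open>A\<close>, the operation \<open>g \<mapsto> p \<cdot> (A \<ltimes> g) \<cdot> (j \<rtimes> X)\<close> multiplies by the
  unit on the left and \<open>f \<mapsto> p \<cdot> (f \<rtimes> A) \<cdot> (X \<ltimes> j)\<close> multiplies by it on the right. The first of
  these needs the interchanger because \<open>l\<close> starts at \<open>p \<cdot> (j \<rtimes> A)\<close>, with \<open>j\<close> applied after
  \<open>g\<close>; dually for the second.\<close>

lemma lunitor_typing [simp]:
  assumes "g \<in> Arr B" "Cod B g = A"
  shows "lunitor g \<in> Cell B" "Src B (lunitor g) = p \<cdot> (A \<ltimes> g) \<cdot> (j \<rtimes> Dom B g)"
    "Tgt B (lunitor g) = g"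
  using assms by (auto simp: lunitor_def)

lemma runitor_typing [simp]:
  assumes "f \<in> Arr B" "Cod B f = A"
  shows "runitor f \<in> Cell B" "Src B (runitor f) = f"
    "Tgt B (runitor f) = p \<cdot> (f \<rtimes> A) \<cdot> (Dom B f \<ltimes> j)"
  using assms by (auto simp: runitor_def)

lemma lunitor_id [simp]: "lunitor (\<one> A) = l"
  by (simp add: lunitor_def)

lemma runitor_id [simp]: "runitor (\<one> A) = r"
  by (simp add: runitor_def)

text \<open>Naturality combines that of the interchanger, which moves \<open>y\<close> past \<open>\<chi>\<close>, with the
  exchange of \<open>y\<close> and \<open>l\<close>.\<close>

lemma lunitor_natural:
  assumes y: "y \<in> Cell B" "Cod B (Src B y) = A"
  shows "lunitor (Tgt B y) \<bullet> (p \<rhd> ((A \<ltimes>\<^sub>2 y) \<lhd> (j \<rtimes> Dom B (Src B y))))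
    = y \<bullet> lunitor (Src B y)"
proof -
  let ?X = "Dom B (Src B y)"
  have "lunitor (Tgt B y) \<bullet> (p \<rhd> ((A \<ltimes>\<^sub>2 y) \<lhd> (j \<rtimes> ?X)))
    = (l \<lhd> Tgt B y) \<bullet> (p \<rhd> (\<chi> j (Tgt B y) \<bullet> ((A \<ltimes>\<^sub>2 y) \<lhd> (j \<rtimes> ?X))))"
    using y by (simp add: lunitor_def)
  also have "\<dots> = (l \<lhd> Tgt B y) \<bullet> (p \<rhd> (((j \<rtimes> A) \<rhd> y) \<bullet> \<chi> j (Src B y)))"
    using chi_natural_right[of j y] y by simp
  also have "\<dots> = ((l \<lhd> Tgt B y) \<bullet> (Src B l \<rhd> y)) \<bullet> (p \<rhd> \<chi> j (Src B y))"
    using y by simp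
  also have "\<dots> = ((Tgt B l \<rhd> y) \<bullet> (l \<lhd> Src B y)) \<bullet> (p \<rhd> \<chi> j (Src B y))"
    using whisk_exchange[of y l] y by (simp del: vcomp_assoc')
  also have "\<dots> = y \<bullet> lunitor (Src B y)"
    using y by (simp add: lunitor_def)
  finally show ?thesis .
qed

lemma runitor_natural:
  assumes x: "x \<in> Cell B" "Cod B (Src B x) = A"
  shows "runitor (Tgt B x) \<bullet> x
    = (p \<rhd> ((x \<rtimes>\<^sub>2 A) \<lhd> (Dom B (Src B x) \<ltimes> j))) \<bullet> runitor (Src B x)"
proof -
  let ?X = "Dom B (Src B x)"
  have "runitor (Tgt B x) \<bullet> x = (p \<rhd> \<chi> (Tgt B x) j) \<bullet> ((r \<lhd> Tgt B x) \<bullet> (Src B r \<rhd> x))"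
    using x by (simp add: runitor_def)
  also have "\<dots> = (p \<rhd> \<chi> (Tgt B x) j) \<bullet> ((Tgt B r \<rhd> x) \<bullet> (r \<lhd> Src B x))"
    using whisk_exchange[of x r] x by simp
  also have "\<dots> = (p \<rhd> (\<chi> (Tgt B x) j \<bullet> ((A \<ltimes> j) \<rhd> x))) \<bullet> (r \<lhd> Src B x)"
    using x by simp
  also have "\<dots> = (p \<rhd> (((x \<rtimes>\<^sub>2 A) \<lhd> (?X \<ltimes> j)) \<bullet> \<chi> (Src B x) j)) \<bullet> (r \<lhd> Src B x)"
    using chi_natural_left[of x j] x by simp
  also have "\<dots> = (p \<rhd> ((x \<rtimes>\<^sub>2 A) \<lhd> (?X \<ltimes> j))) \<bullet> runitor (Src B x)"
    using x by (simp add: runitor_def)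
  finally show ?thesis .
qed

lemma lunitor_comp:
  assumes "g \<in> Arr B" "h \<in> Arr B" "Dom B g = Cod B h" "Cod B g = A"
  shows "lunitor (g \<cdot> h) = (lunitor g \<lhd> h) \<bullet> ((p \<cdot> (A \<ltimes> g)) \<rhd> \<chi> j h)"
  using assms by (simp add: lunitor_def chi_comp_right')

lemma runitor_comp:
  assumes "f \<in> Arr B" "h \<in> Arr B" "Dom B f = Cod B h" "Cod B f = A"
  shows "runitor (f \<cdot> h) = ((p \<cdot> (f \<rtimes> A)) \<rhd> \<chi> h j) \<bullet> (runitor f \<lhd> h)"
  using assms by (simp add: runitor_def chi_comp_left')

text \<open>The axiom \<open>left_unit_assoc\<close> compares \<open>p \<rhd> (l \<rtimes>\<^sub>2 A)\<close> with the constraint at \<open>p\<close>, so it is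
  the case \<open>g = \<one> A\<close> of the next lemma. The general case follows by exchanging \<open>\<alpha>\<close> with the
  interchanger of \<open>j\<close> and \<open>g \<rtimes> A\<close>, which then merges with the one of \<open>j\<close> and \<open>p\<close>.\<close>

lemma lunitor_rtensor:
  assumes g: "g \<in> Arr B" "Cod B g = A"
  shows "p \<rhd> (lunitor g \<rtimes>\<^sub>2 A)
    = lunitor (p \<cdot> (g \<rtimes> A)) \<bullet> (\<alpha> \<lhd> ((A \<ltimes> (g \<rtimes> A)) \<cdot> (j \<rtimes> (Dom B g \<otimes> A))))"
proof -
  let ?g = "g \<rtimes> A" and ?c = "\<chi> j (g \<rtimes> A)" and ?jj = "j \<rtimes> (A \<otimes> A)"
  have "p \<rhd> (lunitor g \<rtimes>\<^sub>2 A) = ((p \<rhd> (l \<rtimes>\<^sub>2 A)) \<lhd> ?g) \<bullet> ((p \<cdot> (p \<rtimes> A)) \<rhd> ?c)"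
    using g by (simp add: lunitor_def)
  also have "\<dots> = ((lunitor p \<bullet> (\<alpha> \<lhd> ?jj)) \<lhd> ?g) \<bullet> (Src B \<alpha> \<rhd> ?c)"
    using g by (simp add: left_unit_assoc[symmetric] lunitor_def)
  also have "\<dots> = (lunitor p \<lhd> ?g) \<bullet> ((\<alpha> \<lhd> Tgt B ?c) \<bullet> (Src B \<alpha> \<rhd> ?c))"
    using g by simp
  also have "\<dots> = (lunitor p \<lhd> ?g) \<bullet> ((Tgt B \<alpha> \<rhd> ?c) \<bullet> (\<alpha> \<lhd> Src B ?c))"
    using whisk_exchange[of ?c \<alpha>] g by simp
  also have "\<dots> = lunitor (p \<cdot> ?g) \<bullet> (\<alpha> \<lhd> ((A \<ltimes> ?g) \<cdot> (j \<rtimes> (Dom B g \<otimes> A))))"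
    using g by (simp add: lunitor_comp)
  finally show ?thesis .
qed

text \<open>The dual, obtained from \<open>right_unit_assoc\<close>.\<close>

lemma runitor_ltensor:
  assumes f: "f \<in> Arr B" "Cod B f = A"
  shows "p \<rhd> (A \<ltimes>\<^sub>2 runitor f)
    = (\<alpha> \<lhd> ((A \<ltimes> (f \<rtimes> A)) \<cdot> ((A \<otimes> Dom B f) \<ltimes> j))) \<bullet> runitor (p \<cdot> (A \<ltimes> f))"
proof -
  let ?f = "A \<ltimes> f" and ?c = "\<chi> (A \<ltimes> f) j" and ?jj = "(A \<otimes> A) \<ltimes> j"
  have "p \<rhd> (A \<ltimes>\<^sub>2 runitor f) = ((p \<cdot> (A \<ltimes> p)) \<rhd> ?c) \<bullet> ((p \<rhd> (A \<ltimes>\<^sub>2 r)) \<lhd> ?f)"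
    using f by (simp add: runitor_def)
  also have "\<dots> = (Tgt B \<alpha> \<rhd> ?c) \<bullet> (((\<alpha> \<lhd> ?jj) \<bullet> runitor p) \<lhd> ?f)"
    using f by (simp add: right_unit_assoc[symmetric] runitor_def)
  also have "\<dots> = ((Tgt B \<alpha> \<rhd> ?c) \<bullet> (\<alpha> \<lhd> Src B ?c)) \<bullet> (runitor p \<lhd> ?f)"
    using f by simp
  also have "\<dots> = ((\<alpha> \<lhd> Tgt B ?c) \<bullet> (Src B \<alpha> \<rhd> ?c)) \<bullet> (runitor p \<lhd> ?f)"
    using whisk_exchange[of ?c \<alpha>] f by (simp del: vcomp_assoc')
  also have "\<dots> = (\<alpha> \<lhd> ((A \<ltimes> (f \<rtimes> A)) \<cdot> ((A \<otimes> Dom B f) \<ltimes> j))) \<bullet> runitor (p \<cdot> ?f)"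
    using f by (simp add: runitor_comp)
  finally show ?thesis .
qed

end

section \<open>The comparison of two units\<close>

locale two_skew_units =
  U: skew_unit B A p \<alpha> j l r + U': skew_unit B A p \<alpha> j' l' r'
  for B :: "('o, 'a, 'c, 'm) gray_data_scheme" (structure) and A p \<alpha> j l r j' l' r'
begin

definition comparison :: 'c where
  "comparison = U.lunitor j' \<bullet> (r' \<lhd> j)"

text \<open>The interchanger of \<open>j\<close> and \<open>j'\<close> in the middle can be grouped with \<open>l\<close> or with \<open>r'\<close>. The
  first grouping suits the compatibility with the left constraints, the second that with the
  right constraints.\<close>

lemma comparison_eq_runitor: "comparison = (l \<lhd> j') \<bullet> U'.runitor j"
  by (simp add: comparison_def U.lunitor_def U'.runitor_def)

lemma comparison_typing [simp]:
  "comparison \<in> Cell B" "Src B comparison = j" "Tgt B comparison = j'"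
  by (simp_all add: comparison_def)

text \<open>After \<open>lunitor_rtensor\<close> has replaced \<open>p \<rhd> (U.lunitor j' \<rtimes>\<^sub>2 A)\<close> by a constraint at
  \<open>p \<cdot> (j' \<rtimes> A)\<close>, the source of \<open>l'\<close>, naturality lets \<open>l'\<close> act first and leaves the constraint
  at the identity, which is \<open>l\<close>. The 2-cells before it form the triangle of the second unit,
  whiskered with \<open>j \<rtimes> A\<close>.\<close>

lemma comparison_left: "l' \<bullet> (p \<rhd> (comparison \<rtimes>\<^sub>2 A)) = l"
proof -
  let ?t = "(\<alpha> \<lhd> (A \<ltimes> (j' \<rtimes> A))) \<bullet> (p \<rhd> (r' \<rtimes>\<^sub>2 A))"
  have "l' \<bullet> (p \<rhd> (comparison \<rtimes>\<^sub>2 A))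
    = l' \<bullet> (p \<rhd> (U.lunitor j' \<rtimes>\<^sub>2 A)) \<bullet> (p \<rhd> ((r' \<rtimes>\<^sub>2 A) \<lhd> (j \<rtimes> A)))"
    by (simp add: comparison_def)
  also have "\<dots> = (l' \<bullet> U.lunitor (Src B l')) \<bullet> (?t \<lhd> (j \<rtimes> A))"
    by (simp add: U.lunitor_rtensor)
  also have "\<dots> = (U.lunitor (Tgt B l') \<bullet> (p \<rhd> ((A \<ltimes>\<^sub>2 l') \<lhd> (j \<rtimes> A)))) \<bullet> (?t \<lhd> (j \<rtimes> A))"
    using U.lunitor_natural[of l'] by (simp del: U.vcomp_assoc')
  also have "\<dots> = l \<bullet> (((p \<rhd> (A \<ltimes>\<^sub>2 l')) \<bullet> ?t) \<lhd> (j \<rtimes> A))"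
    by simp
  also have "\<dots> = l"
    unfolding U'.triangle by simp
  finally show ?thesis .
qed

text \<open>Dually, \<open>r\<close> is moved past the right constraint of the second unit, and the triangle of the
  first unit, whiskered with \<open>A \<ltimes> j'\<close>, cancels.\<close>

lemma comparison_right: "(p \<rhd> (A \<ltimes>\<^sub>2 comparison)) \<bullet> r = r'"
proof -
  let ?t = "(p \<rhd> (A \<ltimes>\<^sub>2 l)) \<bullet> (\<alpha> \<lhd> (A \<ltimes> (j \<rtimes> A)))"
  have "(p \<rhd> (A \<ltimes>\<^sub>2 comparison)) \<bullet> r
    = (p \<rhd> ((A \<ltimes>\<^sub>2 l) \<lhd> (A \<ltimes> j'))) \<bullet> (p \<rhd> (A \<ltimes>\<^sub>2 U'.runitor j)) \<bullet> r"
    by (simp add: comparison_eq_runitor)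
  also have "\<dots> = (?t \<lhd> (A \<ltimes> j')) \<bullet> (U'.runitor (Tgt B r) \<bullet> r)"
    by (simp add: U'.runitor_ltensor)
  also have "\<dots> = (?t \<lhd> (A \<ltimes> j')) \<bullet> ((p \<rhd> ((r \<rtimes>\<^sub>2 A) \<lhd> (A \<ltimes> j'))) \<bullet> U'.runitor (Src B r))"
    using U'.runitor_natural[of r] by simp
  also have "\<dots> = (((p \<rhd> (A \<ltimes>\<^sub>2 l)) \<bullet> (\<alpha> \<lhd> (A \<ltimes> (j \<rtimes> A))) \<bullet> (p \<rhd> (r \<rtimes>\<^sub>2 A))) \<lhd> (A \<ltimes> j')) \<bullet> r'"
    by simp
  also have "\<dots> = r'"
    unfolding U.triangle by simp
  finally show ?thesis .
qed

lemma comparison_in_unit_hom: "comparison \<in> unit_hom B A p (j, l, r) (j', l', r')"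
  by (simp add: unit_hom_def hom2_def comparison_left comparison_right)

text \<open>Substituting \<open>p \<rhd> (A \<ltimes>\<^sub>2 \<phi>)\<close> after \<open>r\<close> for \<open>r'\<close> and using naturality exhibits the
  comparison as \<open>\<phi>\<close> after the endomorphism of \<open>j\<close> in \<open>unit_unit\<close>.\<close>

lemma unit_hom_eq_comparison:
  assumes "\<phi> \<in> unit_hom B A p (j, l, r) (j', l', r')"
  shows "\<phi> = comparison"
proof -
  from assms have phi [simp]: "\<phi> \<in> Cell B" "Src B \<phi> = j" "Tgt B \<phi> = j'"
    and r': "(p \<rhd> (A \<ltimes>\<^sub>2 \<phi>)) \<bullet> r = r'"
    by (auto simp: unit_hom_def hom2_def)
  have "comparison = U.lunitor j' \<bullet> (((p \<rhd> (A \<ltimes>\<^sub>2 \<phi>)) \<bullet> r) \<lhd> j)"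
    unfolding r' by (rule comparison_def)
  also have "\<dots> = (U.lunitor (Tgt B \<phi>) \<bullet> (p \<rhd> ((A \<ltimes>\<^sub>2 \<phi>) \<lhd> j))) \<bullet> (r \<lhd> j)"
    by simp
  also have "\<dots> = (\<phi> \<bullet> U.lunitor j) \<bullet> (r \<lhd> j)"
    using U.lunitor_natural[of \<phi>] by simp
  also have "\<dots> = \<phi> \<bullet> ((l \<lhd> j) \<bullet> (p \<rhd> \<chi> j j) \<bullet> (r \<lhd> j))"
    by (simp add: U.lunitor_def)
  also have "\<dots> = \<phi>"
    unfolding U.unit_unit by simp
  finally show ?thesis ..
qed

end

theorem proposition3p2:
  fixes B :: "('o, 'a, 'c, 'm) gray_data_scheme"
    and A :: 'o and p j j' :: 'a and \<alpha> l r l' r' :: 'c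
  assumes "gray_monoid B"
    and "skew_semimonoidale B A p \<alpha>"
    and "(j, l, r) \<in> units B A p \<alpha>"
    and "(j', l', r') \<in> units B A p \<alpha>"
  shows "\<exists>!\<phi>. \<phi> \<in> unit_hom B A p (j, l, r) (j', l', r')"
proof -
  interpret two_skew_units B A p \<alpha> j l r j' l' r'
    using assms(2-4)
    by (simp add: two_skew_units_def skew_unit_def skew_unit_axioms_def)
  show ?thesis
    using comparison_in_unit_hom unit_hom_eq_comparison by blast
qed

end
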